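(* Let $H$ be a separable complex Hilbert space. Let $S$ be a bounded operator on $H$ such that $0\notin\overline{W(S)}$. Let $T$ be an unbounded, densely defined, closed and hyponormal linear operator with domain $D(T)\subset H$. If $ST^*\subset TS$, then $T$ is self-adjoint, i.e. $T=T^*$.
   Context: The numerical range of a bounded operator $S$ on $H$ is $W(S)=\{\langle Sx,x\rangle: x\in H,\ \|x\|=1\}$, and $\overline{W(S)}$ is its closure in $\mathbb{C}$. "Unbounded" is used in the sense "not necessarily bounded". A densely defined operator $T$ is hyponormal if $D(T)\subset D(T^* )$ and $\|T^*x\|\le\|Tx\|$ for all $x\in D(T)$. For operators $A,B$, $A\subset B$ means $D(A)\subset D(B)$ and $Ax=Bx$ for all $x\in D(A)$. Products are defined by $(AB)x=A(Bx)$ on $D(AB)=\{x\in D(B): Bx\in D(A)\}$. Equality of operators includes equality of domains. *)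

theory Defs
  imports "HOL-Analysis.Analysis"
begin

text \<open>
  Complex inner product spaces, on top of the library's real normed vector spaces (which supply
  norm and topology). The inner product is linear in its \<^emph>\<open>first\<close> argument. Positive
  definiteness is contained in the last axiom.
\<close>

class complex_inner = real_normed_vector +
  fixes scaleC :: "complex \<Rightarrow> 'a \<Rightarrow> 'a"  (infixr \<open>*\<^sub>C\<close> 75)
    and cinner :: "'a \<Rightarrow> 'a \<Rightarrow> complex"
  assumes scaleC_add_right: "c *\<^sub>C (x + y) = c *\<^sub>C x + c *\<^sub>C y"
    and scaleC_add_left: "(c + d) *\<^sub>C x = c *\<^sub>C x + d *\<^sub>C x"
    and scaleC_scaleC: "c *\<^sub>C d *\<^sub>C x = (c * d) *\<^sub>C x"
    and scaleC_one: "1 *\<^sub>C x = x"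
    and scaleR_scaleC: "r *\<^sub>R x = complex_of_real r *\<^sub>C x"
    and cinner_commute: "cinner x y = cnj (cinner y x)"
    and cinner_add_left: "cinner (x + y) z = cinner x z + cinner y z"
    and cinner_scaleC_left: "cinner (c *\<^sub>C x) y = c * cinner x y"
    and cinner_self: "cinner x x = complex_of_real ((norm x)\<^sup>2)"

class complex_hilbert_space = complex_inner + complete_space

instantiation complex :: complex_hilbert_space
begin

definition scaleC_complex :: "complex \<Rightarrow> complex \<Rightarrow> complex" where
  "scaleC_complex c x = c * x"

definition cinner_complex :: "complex \<Rightarrow> complex \<Rightarrow> complex" where
  "cinner_complex x y = x * cnj y"

instance
  by standard
    (auto simp: scaleC_complex_def cinner_complex_def algebra_simps scaleR_conv_of_real
      complex_mult_cnj cmod_power2)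

end

definition bounded_clinear :: "('a::complex_inner \<Rightarrow> 'a) \<Rightarrow> bool" where
  "bounded_clinear S \<longleftrightarrow> bounded_linear S \<and> (\<forall>c x. S (c *\<^sub>C x) = c *\<^sub>C S x)"

definition numerical_range :: "('a::complex_inner \<Rightarrow> 'a) \<Rightarrow> complex set" where
  "numerical_range S = {cinner (S x) x | x. norm x = 1}"

text \<open>
  A not necessarily everywhere defined operator is a partial function \<^typ>\<open>'a \<rightharpoonup> 'a\<close> with domain
  \<^term>\<open>dom T\<close>. Then HOL equality is equality of operators including domains, \<open>A \<subseteq>\<^sub>m B\<close> is the
  extension relation, and \<open>A \<circ>\<^sub>m B\<close> is the product \<open>AB\<close> with domain
  \<open>{x \<in> D(B). Bx \<in> D(A)}\<close>.
\<close>

definition everywhere :: "('a \<Rightarrow> 'a) \<Rightarrow> ('a \<rightharpoonup> 'a)" where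
  "everywhere S = (\<lambda>x. Some (S x))"

definition linear_operator :: "('a::complex_inner \<rightharpoonup> 'a) \<Rightarrow> bool" where
  "linear_operator T \<longleftrightarrow>
     0 \<in> dom T \<and>
     (\<forall>x\<in>dom T. \<forall>y\<in>dom T. x + y \<in> dom T \<and> the (T (x + y)) = the (T x) + the (T y)) \<and>
     (\<forall>c. \<forall>x\<in>dom T. c *\<^sub>C x \<in> dom T \<and> the (T (c *\<^sub>C x)) = c *\<^sub>C the (T x))"

definition densely_defined :: "('a::complex_inner \<rightharpoonup> 'a) \<Rightarrow> bool" where
  "densely_defined T \<longleftrightarrow> closure (dom T) = UNIV"

definition closed_operator :: "('a::complex_inner \<rightharpoonup> 'a) \<Rightarrow> bool" where
  "closed_operator T \<longleftrightarrow> closed (Map.graph T)"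

text \<open>
  \<open>y \<in> D(T\<^sup>*)\<close> iff some \<open>z\<close> satisfies \<open>\<langle>Tx, y\<rangle> = \<langle>x, z\<rangle>\<close> for all \<open>x \<in> D(T)\<close>, and then
  \<open>T\<^sup>*y = z\<close>. The vector \<open>z\<close> is unique if \<open>T\<close> is densely defined; otherwise the adjoint is
  not meaningful.
\<close>

definition adjoint_op :: "('a::complex_inner \<rightharpoonup> 'a) \<Rightarrow> ('a \<rightharpoonup> 'a)" where
  "adjoint_op T = (\<lambda>y.
     if \<exists>z. \<forall>x\<in>dom T. cinner (the (T x)) y = cinner x z
     then Some (THE z. \<forall>x\<in>dom T. cinner (the (T x)) y = cinner x z)
     else None)"

definition hyponormal :: "('a::complex_inner \<rightharpoonup> 'a) \<Rightarrow> bool" where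
  "hyponormal T \<longleftrightarrow> densely_defined T \<and> dom T \<subseteq> dom (adjoint_op T) \<and>
     (\<forall>x\<in>dom T. norm (the (adjoint_op T x)) \<le> norm (the (T x)))"

end

theory Submission
  imports Defs "HOL-Complex_Analysis.Complex_Analysis"
begin

text \<open>
  For \<open>x \<in> D(T)\<close> and a complex number \<open>z\<close>, comparing \<open>\<langle>TSx, x\<rangle> = \<langle>Sx, T\<^sup>*x\<rangle>\<close> with
  \<open>\<langle>ST\<^sup>*x, x\<rangle>\<close> and writing \<open>T\<^sup>*x\<close> as the conjugate of \<open>z\<close> times \<open>x\<close> plus an error gives
  \<open>\<bar>Im z\<bar> \<bar>\<langle>Sx, x\<rangle>\<bar> \<le> \<parallel>S\<parallel> \<parallel>x\<parallel> \<parallel>(T - z)x\<parallel>\<close>: hyponormality bounds the error by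
  \<open>\<parallel>(T - z)x\<parallel>\<close>. As \<open>0\<close> has positive distance to the numerical range of \<open>S\<close>, this bounds
  \<open>T - z\<close> below by a fixed multiple of \<open>\<bar>Im z\<bar>\<close> (\<open>intertwined_shift_lower_bound\<close>). If \<open>z\<close> is
  not real and \<open>T\<^sup>*y = zy\<close>, then \<open>TSy = zSy\<close>, so \<open>Sy = 0\<close> and hence \<open>y = 0\<close>. Since \<open>T\<close> is closed,
  it follows that \<open>T - z\<close> is onto (\<open>surj_shift_if_adjoint_inj\<close>). In short, the spectrum of \<open>T\<close>
  is real and its resolvent is \<open>O(1 / \<bar>Im z\<bar>)\<close>.

  A closed hyponormal operator with real spectrum is self-adjoint because its resolvent is
  normaloid: the norm of the inverse of \<open>T - z\<close> equals its spectral radius, so the multiple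
  above can be taken to be exactly \<open>\<bar>Im z\<bar>\<close> (\<open>hyponormal_shift_lower_bound\<close>). Concretely, the
  norms of the vectors obtained by applying this inverse repeatedly to a fixed vector form a
  logarithmically convex sequence (\<open>hyponormal_log_convex\<close>), while Cauchy's inequalities for
  the resolvent bound their growth (\<open>resolvent_power_bound\<close>).
  Letting \<open>z\<close> tend to infinity along the imaginary axis in \<open>\<bar>Im z\<bar> \<parallel>x\<parallel> \<le> \<parallel>(T - z)x\<parallel>\<close> shows that
  \<open>\<langle>Tx, x\<rangle>\<close> is real (\<open>Im_cinner_eq_0_if_shift_lower_bound\<close>). So \<open>T\<close> is symmetric, and
  surjectivity of \<open>T - \<i>\<close> makes it self-adjoint (\<open>self_adjoint_if_symmetric_and_surj\<close>).
\<close>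

section \<open>Complex inner product spaces\<close>

lemma cinner_add_right: "cinner x (y + z) = cinner x y + cinner (x::'a::complex_inner) z"
  by (metis cinner_add_left cinner_commute complex_cnj_add)

lemma cinner_scaleC_right: "cinner x (c *\<^sub>C y) = cnj c * cinner (x::'a::complex_inner) y"
  by (metis cinner_commute cinner_scaleC_left complex_cnj_mult)

lemma scaleC_minus_one: "(-1) *\<^sub>C (x::'a::complex_inner) = - x"
  using scaleR_scaleC[of "-1" x] by simp

lemma cinner_minus_left: "cinner (- x) y = - cinner (x::'a::complex_inner) y"
  using cinner_scaleC_left[of "-1" x y] by (simp add: scaleC_minus_one)

lemma cinner_minus_right: "cinner x (- y) = - cinner (x::'a::complex_inner) y"
  using cinner_scaleC_right[of x "-1" y] by (simp add: scaleC_minus_one)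

lemma cinner_diff_left: "cinner (x - y) z = cinner x z - cinner (y::'a::complex_inner) z"
  using cinner_add_left[of x "-y" z] by (simp add: cinner_minus_left)

lemma cinner_diff_right: "cinner x (y - z) = cinner x y - cinner (x::'a::complex_inner) z"
  using cinner_add_right[of x y "-z"] by (simp add: cinner_minus_right)

lemma cinner_zero_left: "cinner 0 (y::'a::complex_inner) = 0"
  using cinner_diff_left[of 0 0 y] by simp

lemma cinner_zero_right: "cinner (x::'a::complex_inner) 0 = 0"
  using cinner_diff_right[of x 0 0] by simp

lemmas cinner_linear =
  cinner_add_left cinner_add_right cinner_diff_left cinner_diff_right
  cinner_scaleC_left cinner_scaleC_right cinner_zero_left cinner_zero_right
  cinner_minus_left cinner_minus_right

lemma norm_scaleC: "norm (c *\<^sub>C x) = cmod c * norm (x::'a::complex_inner)"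
proof -
  have "complex_of_real ((norm (c *\<^sub>C x))\<^sup>2) = (c * cnj c) * cinner x x"
    unfolding cinner_self[symmetric] by (simp add: cinner_linear)
  also have "\<dots> = complex_of_real ((cmod c * norm x)\<^sup>2)"
    by (simp only: complex_norm_square[symmetric] cinner_self of_real_mult power_mult_distrib)
  finally have "complex_of_real ((norm (c *\<^sub>C x))\<^sup>2) = complex_of_real ((cmod c * norm x)\<^sup>2)" .
  then show ?thesis
    by (metis of_real_eq_iff norm_ge_zero power2_eq_imp_eq mult_nonneg_nonneg)
qed

lemma scaleC_diff_right: "c *\<^sub>C (x - y) = c *\<^sub>C x - c *\<^sub>C (y::'a::complex_inner)"
  by (metis add_diff_cancel diff_add_cancel scaleC_add_right)

lemma scaleC_zero_right: "c *\<^sub>C (0::'a::complex_inner) = 0"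
  using scaleC_diff_right[of c "0::'a" 0] by simp

lemma bounded_linear_scaleC: "bounded_linear (\<lambda>x::'a::complex_inner. c *\<^sub>C x)"
proof (rule bounded_linear_intro[of _ "cmod c"])
  show "c *\<^sub>C (r *\<^sub>R x) = r *\<^sub>R (c *\<^sub>C x)" for r and x :: 'a
    by (simp add: scaleR_scaleC scaleC_scaleC mult.commute)
qed (simp_all add: scaleC_add_right norm_scaleC)

lemma norm_add_power2:
  "(norm (x + y))\<^sup>2 = (norm x)\<^sup>2 + 2 * Re (cinner x y) + (norm (y::'a::complex_inner))\<^sup>2"
proof -
  have "complex_of_real ((norm (x + y))\<^sup>2) =
      of_real ((norm x)\<^sup>2) + (cinner x y + cnj (cinner x y)) + of_real ((norm y)\<^sup>2)"
    using cinner_commute[of y x] by (simp add: cinner_self[symmetric] cinner_linear del: of_real_power)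
  then show ?thesis
    by (auto dest: arg_cong[where f=Re] simp del: of_real_power)
qed

lemma norm_diff_power2:
  "(norm (x - y))\<^sup>2 = (norm x)\<^sup>2 - 2 * Re (cinner x y) + (norm (y::'a::complex_inner))\<^sup>2"
  using norm_add_power2[of x "-y"] by (simp add: cinner_linear)

lemma Re_cinner_le: "Re (cinner x y) \<le> norm x * norm (y::'a::complex_inner)"
proof -
  have "(norm (x + y))\<^sup>2 \<le> (norm x + norm y)\<^sup>2"
    by (simp add: norm_triangle_ineq power_mono)
  then show ?thesis
    by (simp add: norm_add_power2 power2_sum)
qed

text \<open>The triangle inequality of the norm yields \<open>Re_cinner_le\<close>; rotating \<open>x\<close> so that the inner product becomes
  its own modulus turns this into the Cauchy--Schwarz inequality.\<close>

lemma cinner_cauchy_schwarz: "cmod (cinner x y) \<le> norm x * norm (y::'a::complex_inner)"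
proof (cases "cinner x y = 0")
  case False
  define c where "c = cnj (cinner x y) / cmod (cinner x y)"
  have c: "cmod c = 1"
    using False by (simp add: c_def norm_divide)
  have "c * cinner x y = of_real (cmod (cinner x y))"
    using False complex_norm_square[of "cinner x y"]
    by (simp add: c_def power2_eq_square mult.commute nonzero_divide_eq_eq)
  then have "cmod (cinner x y) = Re (cinner (c *\<^sub>C x) y)"
    by (simp add: cinner_linear)
  also have "\<dots> \<le> norm x * norm y"
    using Re_cinner_le[of "c *\<^sub>C x" y] by (simp add: norm_scaleC c)
  finally show ?thesis .
qed simp

lemma cinner_scaleR_left: "cinner (r *\<^sub>R x) y = r *\<^sub>R cinner (x::'a::complex_inner) y"
  by (simp only: scaleR_scaleC[of r x] cinner_scaleC_left scaleR_conv_of_real)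

lemma bounded_linear_cinner_left: "bounded_linear (\<lambda>x::'a::complex_inner. cinner x y)"
  by (rule bounded_linear_intro[of _ "norm y"])
    (simp_all add: cinner_add_left cinner_scaleR_left cinner_cauchy_schwarz)

lemma parallelogram_law:
  "(norm (x + y))\<^sup>2 + (norm (x - y))\<^sup>2 = 2 * (norm x)\<^sup>2 + 2 * (norm (y::'a::complex_inner))\<^sup>2"
  by (simp add: norm_add_power2 norm_diff_power2)

text \<open>A minimising sequence for the distance from \<open>w\<close> to \<open>M\<close> is Cauchy by the parallelogram law,
  because midpoints stay in \<open>M\<close>.\<close>

lemma closest_point_in_subspace:
  fixes M :: "'a::complex_hilbert_space set"
  assumes cl: "closed M" and "0 \<in> M"
    and add: "\<And>x y. x \<in> M \<Longrightarrow> y \<in> M \<Longrightarrow> x + y \<in> M"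
    and scale: "\<And>c x. x \<in> M \<Longrightarrow> c *\<^sub>C x \<in> M"
  obtains m where "m \<in> M" "\<And>x. x \<in> M \<Longrightarrow> norm (w - m) \<le> norm (w - x)"
proof -
  define d where "d = infdist w M"
  have ne: "M \<noteq> {}" using \<open>0 \<in> M\<close> by auto
  have dle: "d \<le> norm (w - x)" if "x \<in> M" for x
    using infdist_le[OF that, of w] by (simp add: d_def dist_norm)
  have d0: "0 \<le> d" by (simp add: d_def infdist_nonneg)
  have "\<exists>m\<in>M. (norm (w - m))\<^sup>2 < d\<^sup>2 + 1 / real (Suc n)" for n
  proof -
    define e where "e = sqrt (d\<^sup>2 + 1 / real (Suc n))"
    have "d < e"
      using d0 by (simp add: e_def real_less_rsqrt)
    then obtain m where m: "m \<in> M" "dist w m < e"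
      using ne infdist_notempty[OF ne, of w] cINF_less_iff[of M "dist w" e]
      by (auto simp: d_def)
    have "(norm (w - m))\<^sup>2 < e\<^sup>2"
      using m by (intro power_strict_mono) (auto simp: dist_norm)
    also have "e\<^sup>2 = d\<^sup>2 + 1 / real (Suc n)"
      by (simp add: e_def add_nonneg_nonneg)
    finally show ?thesis using m by blast
  qed
  then obtain m where m: "\<And>n. m n \<in> M" "\<And>n. (norm (w - m n))\<^sup>2 < d\<^sup>2 + 1 / real (Suc n)"
    by metis
  have close: "(norm (m i - m j))\<^sup>2 < 2 / real (Suc i) + 2 / real (Suc j)" for i j
  proof -
    (* The midpoint of m i and m j lies in M, so its distance to w is at least d. *)
    let ?h = "(1/2) *\<^sub>R (m i + m j)"
    have "(w - m i) + (w - m j) = 2 *\<^sub>R (w - ?h)"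
      by (simp add: algebra_simps scaleR_2)
    then have eq: "norm ((w - m i) + (w - m j)) = 2 * norm (w - ?h)"
      by simp
    have "?h \<in> M"
      unfolding scaleR_scaleC[of "1/2"] by (intro scale add m)
    then have "d\<^sup>2 \<le> (norm (w - ?h))\<^sup>2"
      by (intro power_mono dle d0)
    then have "4 * d\<^sup>2 \<le> (norm ((w - m i) + (w - m j)))\<^sup>2"
      by (simp add: eq power_mult_distrib)
    then show ?thesis
      using parallelogram_law[of "w - m i" "w - m j"] m(2)[of i] m(2)[of j]
      by (simp add: norm_minus_commute[of "m i"])
  qed
  have "Cauchy m"
  proof (rule metric_CauchyI)
    fix e :: real assume e: "0 < e"
    obtain N where N: "4 / e\<^sup>2 < real N"
      using reals_Archimedean2 by blast
    have "dist (m i) (m j) < e" if "i \<ge> N" "j \<ge> N" for i j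
    proof -
      have N': "4 < e\<^sup>2 * real (Suc N)"
        using N e by (simp add: field_simps) (smt (verit) zero_less_power)
      have "2 / real (Suc i) \<le> 2 / real (Suc N)" "2 / real (Suc j) \<le> 2 / real (Suc N)"
        using that by (auto intro!: divide_left_mono)
      moreover have "4 / real (Suc N) < e\<^sup>2"
        using N' by (simp add: field_simps)
      ultimately have "(norm (m i - m j))\<^sup>2 < e\<^sup>2"
        using close[of i j] by simp
      then show ?thesis
        using e by (simp add: dist_norm power_less_imp_less_base)
    qed
    then show "\<exists>M. \<forall>i\<ge>M. \<forall>j\<ge>M. dist (m i) (m j) < e" by blast
  qed
  then obtain l where l: "m \<longlonglongrightarrow> l"
    using Cauchy_convergent_iff convergent_def by blast
  have "l \<in> M"
    using closed_sequentially[OF cl] m(1) l by blast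
  moreover have "norm (w - l) \<le> norm (w - x)" if "x \<in> M" for x
  proof -
    have "(\<lambda>n. (norm (w - m n))\<^sup>2) \<longlonglongrightarrow> (norm (w - l))\<^sup>2"
      by (intro tendsto_intros l)
    moreover have "(\<lambda>n. d\<^sup>2 + 1 / real (Suc n)) \<longlonglongrightarrow> d\<^sup>2"
      using LIMSEQ_inverse_real_of_nat_add[of "d\<^sup>2"] by (simp add: inverse_eq_divide)
    ultimately have "(norm (w - l))\<^sup>2 \<le> d\<^sup>2"
      by (rule LIMSEQ_le) (use m(2) in \<open>auto intro: less_imp_le\<close>)
    then show ?thesis
      using d0 dle[OF that] by (meson order_trans power2_le_imp_le)
  qed
  ultimately show thesis by (rule that)
qed

lemma exists_orthogonal_to_closed_subspace:
  fixes M :: "'a::complex_hilbert_space set"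
  assumes cl: "closed M" and "0 \<in> M"
    and add: "\<And>x y. x \<in> M \<Longrightarrow> y \<in> M \<Longrightarrow> x + y \<in> M"
    and scale: "\<And>c x. x \<in> M \<Longrightarrow> c *\<^sub>C x \<in> M"
    and "M \<noteq> UNIV"
  obtains z where "z \<noteq> 0" "\<And>x. x \<in> M \<Longrightarrow> cinner x z = 0"
proof -
  obtain w where w: "w \<notin> M" using \<open>M \<noteq> UNIV\<close> by auto
  obtain m where m: "m \<in> M" and min: "\<And>x. x \<in> M \<Longrightarrow> norm (w - m) \<le> norm (w - x)"
    using closest_point_in_subspace[OF cl \<open>0 \<in> M\<close> add scale] by metis
  define z where "z = w - m"
  have "cinner x z = 0" if x: "x \<in> M" for x
  proof (cases "x = 0")
    case False
    (* Subtracting from z its component along x would bring w closer to M. *)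
    define c where "c = cinner z x / of_real ((norm x)\<^sup>2)"
    have "m + c *\<^sub>C x \<in> M" using m x add scale by blast
    from min[OF this] have "(norm z)\<^sup>2 \<le> (norm (z - c *\<^sub>C x))\<^sup>2"
      by (simp add: z_def diff_diff_eq power_mono)
    also have "\<dots> = (norm z)\<^sup>2 - 2 * Re (cnj c * cinner z x) + (cmod c * norm x)\<^sup>2"
      by (simp add: norm_diff_power2 cinner_linear norm_scaleC)
    also have "cnj c * cinner z x = of_real ((cmod c * norm x)\<^sup>2)"
    proof -
      have "cinner z x = c * of_real ((norm x)\<^sup>2)"
        using False by (simp add: c_def)
      then show ?thesis
        using complex_norm_square[of c] by (simp add: power_mult_distrib mult_ac)
    qed
    finally have "(cmod c * norm x)\<^sup>2 \<le> 0" by (simp del: of_real_power)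
    then have "cmod c * norm x = 0" by simp
    then have "c = 0" using False by simp
    then have "cinner z x = 0" using False by (simp add: c_def)
    then show ?thesis by (metis cinner_commute complex_cnj_zero)
  qed (simp add: cinner_linear)
  moreover have "z \<noteq> 0" using w m by (auto simp: z_def)
  ultimately show thesis using that by blast
qed

section \<open>Unbounded operators and their adjoints\<close>

lemma linear_operator_combination:
  assumes "linear_operator T" "T x = Some u" "T y = Some v"
  shows "T (x + c *\<^sub>C y) = Some (u + c *\<^sub>C v)"
proof -
  have y: "c *\<^sub>C y \<in> dom T" "the (T (c *\<^sub>C y)) = c *\<^sub>C v"
    using assms(1,3) unfolding linear_operator_def by (metis domI option.sel)+
  have "x + c *\<^sub>C y \<in> dom T \<and> the (T (x + c *\<^sub>C y)) = the (T x) + the (T (c *\<^sub>C y))"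
    using assms(1,2) y(1) unfolding linear_operator_def by blast
  then show ?thesis using y assms(2) by auto
qed

lemma linear_operator_zero:
  assumes "linear_operator T"
  shows "T 0 = Some 0"
proof -
  obtain u where u: "T 0 = Some u" using assms by (auto simp: linear_operator_def)
  then show ?thesis
    using linear_operator_combination[OF assms u u, of "-1"] by (simp add: scaleC_minus_one)
qed

text \<open>Two candidates for the value of the adjoint differ by a vector orthogonal to the dense domain,
  so the definite description in the definition is harmless.\<close>

lemma adjoint_op_eq_Some_iff:
  assumes "densely_defined T"
  shows "adjoint_op T y = Some z \<longleftrightarrow> (\<forall>x u. T x = Some u \<longrightarrow> cinner u y = cinner x z)"
proof -
  let ?P = "\<lambda>z. \<forall>x\<in>dom T. cinner (the (T x)) y = cinner x z"
  have unique: "z = z'" if "?P z" "?P z'" for z z'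
  proof -
    have "cinner x (z - z') = 0" if "x \<in> dom T" for x
      using \<open>?P z\<close> \<open>?P z'\<close> that by (simp add: cinner_linear)
    then have "dom T \<subseteq> {x. cinner x (z - z') = 0}" by blast
    moreover have "closed {x. cinner x (z - z') = 0}"
      by (intro closed_Collect_eq bounded_linear.continuous_on[OF bounded_linear_cinner_left]
          continuous_on_id continuous_on_const)
    ultimately have "closure (dom T) \<subseteq> {x. cinner x (z - z') = 0}"
      by (rule closure_minimal)
    then have "cinner (z - z') (z - z') = 0"
      using assms by (auto simp: densely_defined_def)
    then show ?thesis by (simp add: cinner_self)
  qed
  have "adjoint_op T y = Some z \<longleftrightarrow> ?P z"
  proof (cases "\<exists>z. ?P z")
    case True
    then obtain z' where z': "?P z'" by blast
    then have "(THE z. ?P z) = z'"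
      using unique by (intro the_equality) blast+
    then have "adjoint_op T y = Some z'"
      using True by (simp add: adjoint_op_def)
    then show ?thesis using z' unique by auto
  qed (auto simp: adjoint_op_def)
  also have "\<dots> \<longleftrightarrow> (\<forall>x u. T x = Some u \<longrightarrow> cinner u y = cinner x z)"
    by (fastforce simp: dom_def)
  finally show ?thesis .
qed

text \<open>The lower bound makes the range of \<open>T - \<zeta>\<close> closed, and a vector orthogonal to the range is an
  eigenvector of the adjoint.\<close>

lemma surj_shift_if_adjoint_inj:
  fixes T :: "'a::complex_hilbert_space \<rightharpoonup> 'a"
  assumes lin: "linear_operator T" and dense: "densely_defined T" and closed: "closed_operator T"
    and "0 < c" and below: "\<And>x u. T x = Some u \<Longrightarrow> c * norm x \<le> norm (u - \<zeta> *\<^sub>C x)"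
    and inj: "\<And>y. adjoint_op T y = Some (cnj \<zeta> *\<^sub>C y) \<Longrightarrow> y = 0"
  shows "\<exists>x u. T x = Some u \<and> u - \<zeta> *\<^sub>C x = w"
proof -
  define M where "M = {u - \<zeta> *\<^sub>C x | x u. T x = Some u}"
  have comb: "(u - \<zeta> *\<^sub>C x) + a *\<^sub>C (v - \<zeta> *\<^sub>C y)
      = (u + a *\<^sub>C v) - \<zeta> *\<^sub>C (x + a *\<^sub>C y)" for u v x y :: 'a and a
    by (simp add: scaleC_add_right scaleC_diff_right scaleC_scaleC mult.commute)
  have M_comb: "p + a *\<^sub>C q \<in> M" if "p \<in> M" "q \<in> M" for p q a
    using that linear_operator_combination[OF lin] comb unfolding M_def by blast
  have M0: "0 \<in> M"
    using linear_operator_zero[OF lin] by (auto simp: M_def scaleC_zero_right intro!: exI[of _ 0])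
  have "closed M"
    unfolding closed_sequential_limits
  proof (intro allI impI, elim conjE)
    fix p l assume "\<forall>n. p n \<in> M" and pl: "p \<longlonglongrightarrow> l"
    then have "\<forall>n. \<exists>x u. T x = Some u \<and> p n = u - \<zeta> *\<^sub>C x"
      unfolding M_def by blast
    then obtain x u where xu: "\<And>n. T (x n) = Some (u n)" "\<And>n. p n = u n - \<zeta> *\<^sub>C x n"
      by metis
    have diff: "c * norm (x i - x j) \<le> norm (p i - p j)" for i j
    proof -
      have "T (x i - x j) = Some (u i - u j)"
        using linear_operator_combination[OF lin xu(1)[of i] xu(1)[of j], of "-1"]
        by (simp add: scaleC_minus_one)
      from below[OF this] show ?thesis
        by (simp add: xu(2) scaleC_diff_right algebra_simps)
    qed
    have "Cauchy x"
    proof (rule metric_CauchyI)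
      fix e :: real assume "0 < e"
      then have "0 < c * e" using \<open>0 < c\<close> by simp
      moreover have "Cauchy p" using pl by (rule LIMSEQ_imp_Cauchy)
      ultimately obtain N where N: "\<And>i j. i \<ge> N \<Longrightarrow> j \<ge> N \<Longrightarrow> dist (p i) (p j) < c * e"
        by (meson metric_CauchyD)
      have "dist (x i) (x j) < e" if "i \<ge> N" "j \<ge> N" for i j
      proof -
        have "c * norm (x i - x j) < c * e"
          using diff[of i j] N[OF that] by (simp add: dist_norm)
        then show ?thesis using \<open>0 < c\<close> by (simp add: dist_norm)
      qed
      then show "\<exists>N. \<forall>i\<ge>N. \<forall>j\<ge>N. dist (x i) (x j) < e" by blast
    qed
    then obtain a where a: "x \<longlonglongrightarrow> a"
      using Cauchy_convergent_iff convergent_def by blast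
    have "(\<lambda>n. p n + \<zeta> *\<^sub>C x n) \<longlonglongrightarrow> l + \<zeta> *\<^sub>C a"
      by (intro tendsto_add pl bounded_linear.tendsto[OF bounded_linear_scaleC] a)
    then have "u \<longlonglongrightarrow> l + \<zeta> *\<^sub>C a" by (simp add: xu(2))
    then have "(\<lambda>n. (x n, u n)) \<longlonglongrightarrow> (a, l + \<zeta> *\<^sub>C a)"
      using a by (intro tendsto_Pair)
    moreover have "(x n, u n) \<in> Map.graph T" for n
      using xu(1) by (simp add: in_graphI)
    moreover have "closed (Map.graph T)" using closed by (simp add: closed_operator_def)
    ultimately have "(a, l + \<zeta> *\<^sub>C a) \<in> Map.graph T"
      using closed_sequentially[of "Map.graph T" "\<lambda>n. (x n, u n)"] by simp
    then have "T a = Some (l + \<zeta> *\<^sub>C a)" by (rule in_graphD)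
    then show "l \<in> M" unfolding M_def by force
  qed
  have "M = UNIV"
  proof (rule ccontr)
    assume "M \<noteq> UNIV"
    then obtain z where "z \<noteq> 0" and z: "\<And>p. p \<in> M \<Longrightarrow> cinner p z = 0"
      using exists_orthogonal_to_closed_subspace[OF \<open>closed M\<close> M0]
        M_comb[where a = 1] M_comb[OF M0] by (metis add_0 scaleC_one)
    have "cinner u z = cinner x (cnj \<zeta> *\<^sub>C z)" if "T x = Some u" for x u
    proof -
      have "u - \<zeta> *\<^sub>C x \<in> M" using that by (auto simp: M_def)
      from z[OF this] show ?thesis by (simp add: cinner_linear)
    qed
    then have "adjoint_op T z = Some (cnj \<zeta> *\<^sub>C z)"
      by (simp add: adjoint_op_eq_Some_iff[OF dense])
    then show False using inj \<open>z \<noteq> 0\<close> by blast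
  qed
  then have "w \<in> M" by simp
  then show ?thesis unfolding M_def by blast
qed

section \<open>Hyponormal operators with real spectrum\<close>

text \<open>Hyponormality passes from \<open>T\<close> to its translates, since the cross terms in the expansions of
  \<open>\<parallel>T\<^sup>*x - cnj \<zeta> x\<parallel>\<close> and \<open>\<parallel>Tx - \<zeta>x\<parallel>\<close> have the same real part.\<close>

lemma hyponormalE:
  assumes "hyponormal T" "T x = Some u"
  obtains v where "adjoint_op T x = Some v"
    "norm (v - cnj \<zeta> *\<^sub>C x) \<le> norm (u - \<zeta> *\<^sub>C x)"
proof -
  have dense: "densely_defined T" using assms by (simp add: hyponormal_def)
  obtain v where v: "adjoint_op T x = Some v" "norm v \<le> norm u"
  proof -
    have "x \<in> dom T" using assms(2) by blast
    then have "x \<in> dom (adjoint_op T)"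
      and le: "norm (the (adjoint_op T x)) \<le> norm (the (T x))"
      using assms(1) by (auto simp: hyponormal_def)
    then obtain v where "adjoint_op T x = Some v" by blast
    then show ?thesis using that le assms(2) by simp
  qed
  have ux: "cinner u x = cinner x v"
    using v(1) assms(2) adjoint_op_eq_Some_iff[OF dense] by blast
  have "Re (cinner v (cnj \<zeta> *\<^sub>C x)) = Re (\<zeta> * cnj (cinner u x))"
    using cinner_commute[of v x] by (simp add: cinner_linear ux)
  also have "\<dots> = Re (cinner u (\<zeta> *\<^sub>C x))"
    by (simp add: cinner_linear)
  finally have "(norm (v - cnj \<zeta> *\<^sub>C x))\<^sup>2 \<le> (norm (u - \<zeta> *\<^sub>C x))\<^sup>2"
    using v(2) by (simp add: norm_diff_power2 norm_scaleC power_mono)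
  then have "norm (v - cnj \<zeta> *\<^sub>C x) \<le> norm (u - \<zeta> *\<^sub>C x)"
    by (rule power2_le_imp_le) simp
  then show thesis using that v(1) by blast
qed

text \<open>With \<open>A = T - \<zeta>\<close> this is \<open>\<parallel>Ax\<parallel>\<^sup>2 = \<langle>x, A\<^sup>*Ax\<rangle> \<le> \<parallel>x\<parallel> \<parallel>A\<^sup>*Ax\<parallel> \<le> \<parallel>x\<parallel> \<parallel>A\<^sup>2x\<parallel>\<close>. Stating it for
  \<open>A\<close> gives the log-convexity of powers of the inverse of \<open>A\<close> without the adjoint of that inverse.\<close>

lemma hyponormal_log_convex:
  assumes hyp: "hyponormal T"
    and "T x = Some u" "y = u - \<zeta> *\<^sub>C x" "T y = Some w"
  shows "(norm y)\<^sup>2 \<le> norm x * norm (w - \<zeta> *\<^sub>C y)"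
proof -
  have dense: "densely_defined T" using hyp by (simp add: hyponormal_def)
  obtain v where v: "adjoint_op T y = Some v"
    "norm (v - cnj \<zeta> *\<^sub>C y) \<le> norm (w - \<zeta> *\<^sub>C y)"
    using hyponormalE[OF hyp \<open>T y = Some w\<close>] by blast
  have "cinner u y = cinner x v"
    using v(1) \<open>T x = Some u\<close> adjoint_op_eq_Some_iff[OF dense] by blast
  then have "cinner (u - \<zeta> *\<^sub>C x) y = cinner x (v - cnj \<zeta> *\<^sub>C y)"
    by (simp add: cinner_linear)
  then have "complex_of_real ((norm y)\<^sup>2) = cinner x (v - cnj \<zeta> *\<^sub>C y)"
    unfolding assms(3)[symmetric] cinner_self .
  then have "(norm y)\<^sup>2 = cmod (cinner x (v - cnj \<zeta> *\<^sub>C y))"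
    by (metis norm_of_real abs_of_nonneg zero_le_power2)
  also have "\<dots> \<le> norm x * norm (v - cnj \<zeta> *\<^sub>C y)"
    by (rule cinner_cauchy_schwarz)
  also have "\<dots> \<le> norm x * norm (w - \<zeta> *\<^sub>C y)"
    using v(2) by (simp add: mult_left_mono)
  finally show ?thesis .
qed

text \<open>The ratios \<open>a (n + 1) / a n\<close> are nondecreasing, so \<open>a\<close> grows at least like a geometric sequence
  with its initial ratio.\<close>

lemma log_convex_power_le:
  fixes a :: "nat \<Rightarrow> real"
  assumes nonneg: "\<And>n. 0 \<le> a n"
    and log_convex: "\<And>n. (a (Suc n))\<^sup>2 \<le> a n * a (Suc (Suc n))"
  shows "a 1 ^ Suc n \<le> a 0 ^ n * a (Suc n)"
proof -
  have ratio: "a n * a 1 \<le> a (Suc n) * a 0" for n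
  proof (induction n)
    case (Suc n)
    show ?case
    proof (cases "a n = 0")
      case True
      then have "a (Suc n) = 0" using log_convex[of n] by simp
      then show ?thesis using nonneg by simp
    next
      case False
      then have pos: "0 < a n" using nonneg[of n] by simp
      have "a n * (a (Suc n) * a 1) = a (Suc n) * (a n * a 1)" by simp
      also have "\<dots> \<le> a (Suc n) * (a (Suc n) * a 0)"
        by (intro mult_left_mono Suc nonneg)
      also have "\<dots> = (a (Suc n))\<^sup>2 * a 0" by (simp add: power2_eq_square)
      also have "\<dots> \<le> (a n * a (Suc (Suc n))) * a 0"
        by (intro mult_right_mono log_convex nonneg)
      finally have "a n * (a (Suc n) * a 1) \<le> a n * (a (Suc (Suc n)) * a 0)" by (simp add: mult_ac)
      then show ?thesis using pos by simp
    qed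
  qed simp
  show ?thesis
  proof (induction n)
    case (Suc n)
    have "a 1 ^ Suc (Suc n) \<le> (a 0 ^ n * a (Suc n)) * a 1"
      using mult_right_mono[OF Suc nonneg[of 1]] by (simp add: mult_ac)
    also have "\<dots> = a 0 ^ n * (a (Suc n) * a 1)" by simp
    also have "\<dots> \<le> a 0 ^ n * (a (Suc (Suc n)) * a 0)"
      by (intro mult_left_mono ratio zero_le_power nonneg)
    finally show ?case by (simp add: mult_ac)
  qed simp
qed

text \<open>Iterating the resolvent identity expands \<open>\<langle>R \<mu> x, y\<rangle>\<close> around any \<open>\<nu>\<close> as a power series whose
  coefficients are \<open>\<langle>(R \<nu>)\<^sup>k\<^sup>+\<^sup>1 x, y\<rangle>\<close>. So this function of \<open>\<mu>\<close> is holomorphic, and Cauchy's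
  inequality bounds the coefficients at \<open>\<zeta>\<close>.\<close>

lemma resolvent_power_bound:
  fixes R :: "complex \<Rightarrow> 'a::complex_inner \<Rightarrow> 'a"
  assumes lin: "\<And>\<mu> c x y. \<mu> \<in> ball \<zeta> \<rho> \<Longrightarrow> R \<mu> (x + c *\<^sub>C y) = R \<mu> x + c *\<^sub>C R \<mu> y"
    and bound: "\<And>\<mu> x. \<mu> \<in> ball \<zeta> \<rho> \<Longrightarrow> norm (R \<mu> x) \<le> C * norm x"
    and resolvent: "\<And>\<mu> \<nu> x. \<mu> \<in> ball \<zeta> \<rho> \<Longrightarrow> \<nu> \<in> ball \<zeta> \<rho> \<Longrightarrow>
       R \<mu> x = R \<nu> x + (\<mu> - \<nu>) *\<^sub>C R \<nu> (R \<mu> x)"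
    and C: "0 < C" and r: "0 < r" "r < \<rho>"
  shows "norm ((R \<zeta> ^^ Suc n) x) \<le> C * norm x / r ^ n"
proof -
  have pow_lin: "(R \<nu> ^^ n) (p + c *\<^sub>C q) = (R \<nu> ^^ n) p + c *\<^sub>C (R \<nu> ^^ n) q"
    if "\<nu> \<in> ball \<zeta> \<rho>" for \<nu> n p q c
    by (induction n) (simp_all add: lin[OF that])
  have pow_bound: "norm ((R \<nu> ^^ n) p) \<le> C ^ n * norm p" if "\<nu> \<in> ball \<zeta> \<rho>" for \<nu> n p
  proof (induction n)
    case (Suc n)
    have "norm ((R \<nu> ^^ Suc n) p) \<le> C * norm ((R \<nu> ^^ n) p)" using bound[OF that] by simp
    also have "\<dots> \<le> C * (C ^ n * norm p)" using Suc C by simp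
    finally show ?case by simp
  qed simp
  (* Testing against this y turns the coefficient in question into a squared norm. *)
  define y where "y = (R \<zeta> ^^ Suc n) x"
  define f where "f \<mu> = cinner (R \<mu> x) y" for \<mu>
  have expand: "f \<mu> = (\<Sum>k<m. cinner ((R \<nu> ^^ Suc k) x) y * (\<mu> - \<nu>) ^ k)
      + (\<mu> - \<nu>) ^ m * cinner ((R \<nu> ^^ m) (R \<mu> x)) y"
    if "\<mu> \<in> ball \<zeta> \<rho>" "\<nu> \<in> ball \<zeta> \<rho>" for \<mu> \<nu> m
  proof (induction m)
    case (Suc m)
    have "(R \<nu> ^^ m) (R \<mu> x) = (R \<nu> ^^ m) (R \<nu> x + (\<mu> - \<nu>) *\<^sub>C R \<nu> (R \<mu> x))"
      using resolvent[OF that] by metis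
    also have "\<dots> = (R \<nu> ^^ Suc m) x + (\<mu> - \<nu>) *\<^sub>C (R \<nu> ^^ Suc m) (R \<mu> x)"
      by (simp only: pow_lin[OF that(2)] funpow_Suc_right o_apply)
    finally show ?case using Suc by (simp add: cinner_linear algebra_simps del: funpow.simps)
  qed (simp add: f_def)
  have series: "(\<lambda>k. cinner ((R \<nu> ^^ Suc k) x) y * (\<mu> - \<nu>) ^ k) sums f \<mu>"
    if \<mu>: "\<mu> \<in> ball \<zeta> \<rho>" and \<nu>: "\<nu> \<in> ball \<zeta> \<rho>" and small: "cmod (\<mu> - \<nu>) * C < 1" for \<mu> \<nu>
  proof -
    let ?q = "cmod (\<mu> - \<nu>) * C"
    define K where "K = norm (R \<mu> x) * norm y"
    have "(\<lambda>m. (\<mu> - \<nu>) ^ m * cinner ((R \<nu> ^^ m) (R \<mu> x)) y) \<longlonglongrightarrow> 0"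
    proof (rule Lim_null_comparison)
      have "norm ((\<mu> - \<nu>) ^ m * cinner ((R \<nu> ^^ m) (R \<mu> x)) y) \<le> ?q ^ m * K" for m
      proof -
        have "cmod (cinner ((R \<nu> ^^ m) (R \<mu> x)) y) \<le> norm ((R \<nu> ^^ m) (R \<mu> x)) * norm y"
          by (rule cinner_cauchy_schwarz)
        also have "\<dots> \<le> C ^ m * norm (R \<mu> x) * norm y"
          by (intro mult_right_mono pow_bound[OF \<nu>]) simp
        finally have "cmod (cinner ((R \<nu> ^^ m) (R \<mu> x)) y) \<le> C ^ m * K"
          by (simp add: K_def mult_ac)
        then have "cmod (\<mu> - \<nu>) ^ m * cmod (cinner ((R \<nu> ^^ m) (R \<mu> x)) y)
            \<le> cmod (\<mu> - \<nu>) ^ m * (C ^ m * K)"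
          by (rule mult_left_mono) simp
        then show ?thesis by (simp add: norm_mult norm_power power_mult_distrib mult_ac)
      qed
      then show "\<forall>\<^sub>F m in sequentially.
          norm ((\<mu> - \<nu>) ^ m * cinner ((R \<nu> ^^ m) (R \<mu> x)) y) \<le> ?q ^ m * K"
        by simp
      have "(\<lambda>m. ?q ^ m) \<longlonglongrightarrow> 0"
        using small C by (intro LIMSEQ_power_zero) simp
      then show "(\<lambda>m. ?q ^ m * K) \<longlonglongrightarrow> 0" by (rule tendsto_mult_left_zero)
    qed
    from tendsto_diff[OF tendsto_const[of "f \<mu>"] this]
    have "(\<lambda>m. f \<mu> - (\<mu> - \<nu>) ^ m * cinner ((R \<nu> ^^ m) (R \<mu> x)) y) \<longlonglongrightarrow> f \<mu>"
      by simp
    moreover have "f \<mu> - (\<mu> - \<nu>) ^ m * cinner ((R \<nu> ^^ m) (R \<mu> x)) y =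
        (\<Sum>k<m. cinner ((R \<nu> ^^ Suc k) x) y * (\<mu> - \<nu>) ^ k)" for m
      using expand[OF \<mu> \<nu>, of m] by simp
    ultimately show ?thesis
      by (simp only: sums_def)
  qed
  have local_series: "\<exists>s>0. ball \<nu> s \<subseteq> ball \<zeta> \<rho> \<and>
      (\<forall>\<mu>\<in>ball \<nu> s. (\<lambda>k. cinner ((R \<nu> ^^ Suc k) x) y * (\<mu> - \<nu>) ^ k) sums f \<mu>)"
    if \<nu>: "\<nu> \<in> ball \<zeta> \<rho>" for \<nu>
  proof -
    obtain t where t: "0 < t" "ball \<nu> t \<subseteq> ball \<zeta> \<rho>"
      using \<nu> open_ball open_contains_ball_eq by blast
    have "(\<lambda>k. cinner ((R \<nu> ^^ Suc k) x) y * (\<mu> - \<nu>) ^ k) sums f \<mu>"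
      if \<mu>: "\<mu> \<in> ball \<nu> (min t (1 / C))" for \<mu>
    proof (rule series[OF _ \<nu>])
      show "\<mu> \<in> ball \<zeta> \<rho>" using \<mu> t by auto
      show "cmod (\<mu> - \<nu>) * C < 1"
        using \<mu> C by (simp add: dist_norm norm_minus_commute field_simps)
    qed
    then show ?thesis using t C
      by (intro exI[of _ "min t (1 / C)"]) auto
  qed
  have "f holomorphic_on ball \<zeta> \<rho>"
  proof (rule analytic_imp_holomorphic, subst analytic_on_def, intro ballI)
    fix \<nu> assume "\<nu> \<in> ball \<zeta> \<rho>"
    from local_series[OF this] show "\<exists>e>0. f holomorphic_on ball \<nu> e"
      using power_series_holomorphic[of \<nu> _ "\<lambda>k. cinner ((R \<nu> ^^ Suc k) x) y" f] by blast
  qed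
  then have hol: "f holomorphic_on ball \<zeta> r" "continuous_on (cball \<zeta> r) f"
    using r by (auto intro: holomorphic_on_subset holomorphic_on_imp_continuous_on continuous_on_subset
        simp: subset_iff)
  have "\<zeta> \<in> ball \<zeta> \<rho>" using r by simp
  then obtain s where "s > 0" and
    s: "\<And>\<mu>. \<mu> \<in> ball \<zeta> s \<Longrightarrow> (\<lambda>k. cinner ((R \<zeta> ^^ Suc k) x) y * (\<mu> - \<zeta>) ^ k) sums f \<mu>"
    using local_series by meson
  define F where "F = Abs_fps (\<lambda>k. cinner ((R \<zeta> ^^ Suc k) x) y)"
  have "(\<lambda>z. f (\<zeta> + z)) has_fps_expansion F"
  proof (rule has_fps_expansionI)
    have "\<forall>\<^sub>F z in nhds 0. z \<in> ball 0 s"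
      using \<open>s > 0\<close> by (intro eventually_nhds_in_open) auto
    then show "\<forall>\<^sub>F z in nhds 0. (\<lambda>k. fps_nth F k * z ^ k) sums f (\<zeta> + z)"
    proof eventually_elim
      case (elim z)
      then show ?case using s[of "\<zeta> + z"] by (simp add: F_def dist_norm)
    qed
  qed
  then have "fps_nth F n = (deriv ^^ n) (\<lambda>z. f (\<zeta> + z)) 0 / fact n"
    by (rule fps_nth_fps_expansion)
  also have "(deriv ^^ n) (\<lambda>z. f (\<zeta> + z)) 0 = (deriv ^^ n) f \<zeta>"
    using higher_deriv_shift_0[of n f \<zeta>] by (simp add: o_def)
  finally have coeff: "of_real ((norm y)\<^sup>2) = (deriv ^^ n) f \<zeta> / fact n"
    by (simp add: F_def y_def[symmetric] cinner_self del: funpow.simps)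
  have "norm ((deriv ^^ n) f \<zeta>) \<le> fact n * (C * norm x * norm y) / r ^ n"
  proof (rule Cauchy_inequality[OF hol r(1)])
    fix \<mu> assume "norm (\<zeta> - \<mu>) = r"
    then have "\<mu> \<in> ball \<zeta> \<rho>" using r by (simp add: dist_norm)
    have "norm (f \<mu>) \<le> norm (R \<mu> x) * norm y"
      by (simp add: f_def cinner_cauchy_schwarz)
    also have "\<dots> \<le> C * norm x * norm y"
      by (intro mult_right_mono bound \<open>\<mu> \<in> ball \<zeta> \<rho>\<close>) simp
    finally show "norm (f \<mu>) \<le> C * norm x * norm y" .
  qed
  then have "cmod ((deriv ^^ n) f \<zeta> / fact n) \<le> C * norm x * norm y / r ^ n"
    by (simp add: norm_divide field_simps)
  then have "(norm y)\<^sup>2 \<le> C * norm x * norm y / r ^ n"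
    by (simp only: coeff[symmetric] norm_of_real abs_power2)
  then have "norm y * norm y \<le> (C * norm x / r ^ n) * norm y"
    by (simp add: power2_eq_square mult_ac)
  moreover have "0 \<le> C * norm x / r ^ n" using C r by simp
  ultimately have "norm y \<le> C * norm x / r ^ n"
    by (metis mult_le_cancel_right_pos norm_ge_zero order_le_less)
  then show ?thesis by (simp only: y_def)
qed

text \<open>The constant \<open>K\<close> can be removed. If the bound failed at \<open>x\<close>, the resolvent would stretch \<open>w = (T - z)x\<close>
  by a factor larger than \<open>1 / r\<close> for some \<open>r < \<bar>Im z\<bar>\<close>. By log-convexity every further application
  would stretch by at least this factor, while holomorphy on the disc of radius \<open>\<bar>Im z\<bar>\<close> around \<open>z\<close>
  restricts the growth of the iterates to a constant multiple of \<open>r\<close> to the power \<open>-n\<close>; \<open>K\<close> enters only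
  that multiple.\<close>

lemma hyponormal_shift_lower_bound:
  fixes T :: "'a::complex_inner \<rightharpoonup> 'a"
  assumes lin: "linear_operator T" and hyp: "hyponormal T" and "0 < K"
    and below: "\<And>z x u. T x = Some u \<Longrightarrow> \<bar>Im z\<bar> * norm x \<le> K * norm (u - z *\<^sub>C x)"
    and surj: "\<And>z w. Im z \<noteq> 0 \<Longrightarrow> \<exists>x u. T x = Some u \<and> u - z *\<^sub>C x = w"
    and Tx: "T x = Some u"
  shows "\<bar>Im z\<bar> * norm x \<le> norm (u - z *\<^sub>C x)"
proof (rule ccontr)
  define w where "w = u - z *\<^sub>C x"
  assume "\<not> ?thesis"
  then have less: "norm w < \<bar>Im z\<bar> * norm x" by (simp add: w_def)
  then have x: "0 < norm x" and z: "Im z \<noteq> 0"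
    by (auto simp: zero_less_mult_iff intro: ccontr)
  have "norm w / norm x < \<bar>Im z\<bar>" using less x by (simp add: field_simps)
  then obtain r where r: "norm w / norm x < r" "r < \<bar>Im z\<bar>" using dense by blast
  have "0 \<le> norm w / norm x" by simp
  with r have "0 < r" by linarith
  have wr: "norm w < r * norm x" using r(1) x by (simp add: field_simps)

  define R where "R \<mu> p = (SOME x. \<exists>u. T x = Some u \<and> u - \<mu> *\<^sub>C x = p)" for \<mu> p
  have TR: "T (R \<mu> p) = Some (p + \<mu> *\<^sub>C R \<mu> p)" if "Im \<mu> \<noteq> 0" for \<mu> p
  proof -
    have "\<exists>u. T (R \<mu> p) = Some u \<and> u - \<mu> *\<^sub>C R \<mu> p = p"
      unfolding R_def by (rule someI_ex) (use surj[OF that] in blast)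
    then show ?thesis by (metis diff_add_cancel)
  qed
  have R_eq: "R \<mu> (v - \<mu> *\<^sub>C y) = y" if "Im \<mu> \<noteq> 0" "T y = Some v" for \<mu> y v
  proof -
    let ?p = "v - \<mu> *\<^sub>C y"
    have "T (R \<mu> ?p - y) = Some (?p + \<mu> *\<^sub>C R \<mu> ?p - v)"
      using linear_operator_combination[OF lin TR[OF that(1), of ?p] that(2), of "-1"]
      by (simp add: scaleC_minus_one)
    from below[OF this, of \<mu>] have "\<bar>Im \<mu>\<bar> * norm (R \<mu> ?p - y) \<le> 0"
      by (simp add: scaleC_diff_right)
    then show ?thesis using that(1) by (simp add: mult_le_0_iff)
  qed
  have R_lin: "R \<mu> (p + c *\<^sub>C q) = R \<mu> p + c *\<^sub>C R \<mu> q" if "Im \<mu> \<noteq> 0" for \<mu> c p q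
  proof -
    have "(p + \<mu> *\<^sub>C R \<mu> p) + c *\<^sub>C (q + \<mu> *\<^sub>C R \<mu> q) - \<mu> *\<^sub>C (R \<mu> p + c *\<^sub>C R \<mu> q)
        = p + c *\<^sub>C q"
      by (simp add: scaleC_add_right scaleC_scaleC mult.commute)
    then show ?thesis
      using R_eq[OF that linear_operator_combination[OF lin TR[OF that] TR[OF that]]] by metis
  qed
  have R_resolvent: "R \<mu> p = R \<nu> p + (\<mu> - \<nu>) *\<^sub>C R \<nu> (R \<mu> p)"
    if "Im \<mu> \<noteq> 0" "Im \<nu> \<noteq> 0" for \<mu> \<nu> p
  proof -
    have "(p + \<mu> *\<^sub>C R \<mu> p) - \<nu> *\<^sub>C R \<mu> p = p + (\<mu> - \<nu>) *\<^sub>C R \<mu> p"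
      using scaleC_add_left[of "\<mu> - \<nu>" \<nu> "R \<mu> p"] by (simp add: algebra_simps)
    then show ?thesis
      using R_eq[OF that(2) TR[OF that(1)]] R_lin[OF that(2)] by metis
  qed

  (* The resolvent is uniformly bounded on a disc that stays away from the real axis. *)
  define \<rho> where "\<rho> = (r + \<bar>Im z\<bar>) / 2"
  define C where "C = K / (\<bar>Im z\<bar> - \<rho>)"
  have \<rho>: "r < \<rho>" "\<rho> < \<bar>Im z\<bar>" using r(2) by (auto simp: \<rho>_def)
  have C: "0 < C" using \<rho> \<open>0 < K\<close> by (simp add: C_def)
  have Im_ball: "\<bar>Im z\<bar> - \<rho> \<le> \<bar>Im \<mu>\<bar>" if "\<mu> \<in> ball z \<rho>" for \<mu>
    using that abs_Im_le_cmod[of "z - \<mu>"] by (simp add: dist_norm)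
  then have nonreal: "Im \<mu> \<noteq> 0" if "\<mu> \<in> ball z \<rho>" for \<mu>
    using that \<rho> by fastforce
  have R_bound: "norm (R \<mu> p) \<le> C * norm p" if "\<mu> \<in> ball z \<rho>" for \<mu> p
  proof -
    have "(\<bar>Im z\<bar> - \<rho>) * norm (R \<mu> p) \<le> \<bar>Im \<mu>\<bar> * norm (R \<mu> p)"
      by (intro mult_right_mono Im_ball[OF that]) simp
    also have "\<dots> \<le> K * norm p"
      using below[OF TR[OF nonreal[OF that], of p], of \<mu>] by simp
    finally show ?thesis using \<rho> by (simp add: C_def field_simps)
  qed

  define a where "a n = norm ((R z ^^ n) w)" for n
  have a01: "a 0 = norm w" "a (Suc 0) = norm x"
    using R_eq[OF z Tx] by (simp_all add: a_def w_def)
  have "0 \<le> a n" for n by (simp add: a_def)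
  moreover have "(a (Suc n))\<^sup>2 \<le> a n * a (Suc (Suc n))" for n
    using hyponormal_log_convex[OF hyp TR[OF z, of "(R z ^^ Suc n) w"] _ TR[OF z, of "(R z ^^ n) w"],
        where \<zeta> = z]
    by (simp add: a_def mult.commute)
  ultimately have convex: "norm x ^ Suc n \<le> norm w ^ n * a (Suc n)" for n
    using log_convex_power_le[of a n] unfolding One_nat_def a01 by blast
  have growth: "a (Suc n) \<le> C * norm w / r ^ n" for n
    using resolvent_power_bound[where R = R and \<zeta> = z and \<rho> = \<rho> and C = C and r = r and x = w and n = n]
      R_lin[OF nonreal] R_bound R_resolvent[OF nonreal nonreal] C \<rho>(1) \<open>0 < r\<close>
    by (simp add: a_def)
  define q where "q = norm w / (r * norm x)"
  have pos: "0 < r * norm x" using \<open>0 < r\<close> x by simp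
  have q: "0 \<le> q" "q < 1" using wr pos by (simp_all add: q_def field_simps)
  have decay: "norm x \<le> C * norm w * q ^ n" for n
  proof -
    have "norm x ^ Suc n \<le> norm w ^ n * (C * norm w / r ^ n)"
      by (rule order_trans[OF convex mult_left_mono[OF growth]]) simp
    then have "norm x * (r * norm x) ^ n \<le> C * norm w * norm w ^ n"
      using \<open>0 < r\<close> by (simp add: field_simps power_mult_distrib)
    then have "norm x \<le> C * norm w * norm w ^ n / (r * norm x) ^ n"
      using pos by (subst pos_le_divide_eq) simp_all
    then show ?thesis by (simp only: q_def power_divide times_divide_eq_right)
  qed
  have "norm w \<noteq> 0" using decay[of 0] x by auto
  then have "0 < C * norm w" using C by simp
  moreover from this have "0 < norm x / (C * norm w)" using x by simp
  then obtain n where "q ^ n < norm x / (C * norm w)"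
    using real_arch_pow_inv q(2) by blast
  ultimately have "C * norm w * q ^ n < norm x" by (simp add: field_simps)
  with decay[of n] show False by simp
qed

section \<open>Symmetric and self-adjoint operators\<close>

text \<open>Squaring removes the terms quadratic in \<open>t\<close> and leaves a linear function of \<open>t\<close> bounded above.\<close>

lemma Im_cinner_eq_0_if_shift_lower_bound:
  fixes u x :: "'a::complex_inner"
  assumes "\<And>t::real. \<bar>t\<bar> * norm x \<le> norm (u - (\<i> * of_real t) *\<^sub>C x)"
  shows "Im (cinner u x) = 0"
proof (rule ccontr)
  assume nz: "Im (cinner u x) \<noteq> 0"
  have le: "2 * t * Im (cinner u x) \<le> (norm u)\<^sup>2" for t
  proof -
    have "(\<bar>t\<bar> * norm x)\<^sup>2 \<le> (norm (u - (\<i> * of_real t) *\<^sub>C x))\<^sup>2"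
      by (intro power_mono assms) simp
    then show ?thesis
      by (simp add: norm_diff_power2 cinner_linear norm_scaleC norm_mult power_mult_distrib)
  qed
  (* This t makes the left-hand side exceed the bound by 1. *)
  show False
    using le[of "((norm u)\<^sup>2 + 1) / (2 * Im (cinner u x))"] nz by simp
qed

text \<open>Polarisation, with the coefficients \<open>1\<close> and \<open>\<i>\<close>.\<close>

lemma symmetric_if_cinner_real:
  assumes lin: "linear_operator T"
    and real: "\<And>x u. T x = Some u \<Longrightarrow> Im (cinner u x) = 0"
    and Tx: "T x = Some u" and Ty: "T y = Some v"
  shows "cinner u y = cinner x v"
proof -
  have cross: "Im (cnj c * cinner u y + c * cinner v x) = 0" for c
    using real[OF linear_operator_combination[OF lin Tx Ty, of c]] real[OF Tx] real[OF Ty]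
    by (simp add: cinner_linear algebra_simps)
  have "cinner u y = cnj (cinner v x)"
    using cross[of 1] cross[of "\<i>"] by (simp add: complex_eq_iff)
  then show ?thesis using cinner_commute[of x v] by simp
qed

text \<open>For \<open>y \<in> D(T\<^sup>*)\<close> choose \<open>x \<in> D(T)\<close> with \<open>(T - \<zeta>)x = (T\<^sup>* - \<zeta>)y\<close>. As \<open>T\<close> is contained in its
  adjoint, \<open>x - y\<close> lies in the kernel of \<open>T\<^sup>* - \<zeta>\<close>, so \<open>y = x \<in> D(T)\<close>.\<close>

lemma self_adjoint_if_symmetric_and_surj:
  fixes T :: "'a::complex_inner \<rightharpoonup> 'a"
  assumes dense: "densely_defined T"
    and sym: "\<And>x u y v. T x = Some u \<Longrightarrow> T y = Some v \<Longrightarrow> cinner u y = cinner x v"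
    and surj: "\<And>w. \<exists>x u. T x = Some u \<and> u - \<zeta> *\<^sub>C x = w"
    and inj: "\<And>y. adjoint_op T y = Some (\<zeta> *\<^sub>C y) \<Longrightarrow> y = 0"
  shows "T = adjoint_op T"
proof -
  note adj = adjoint_op_eq_Some_iff[OF dense]
  have extends: "adjoint_op T x = Some u" if "T x = Some u" for x u
    using sym that by (auto simp: adj)
  have "T y = Some v" if y: "adjoint_op T y = Some v" for y v
  proof -
    obtain x u where x: "T x = Some u" and eq: "u - \<zeta> *\<^sub>C x = v - \<zeta> *\<^sub>C y"
      using surj by blast
    have uv: "u - v = \<zeta> *\<^sub>C (x - y)"
      using eq by (simp add: scaleC_diff_right algebra_simps)
    have "adjoint_op T (x - y) = Some (u - v)"
      using extends[OF x] y by (simp add: adj cinner_diff_right)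
    then have "x - y = 0" unfolding uv by (rule inj)
    moreover from this have "u = v" using uv by (simp add: scaleC_zero_right)
    ultimately show ?thesis using x by simp
  qed
  then show ?thesis
    using extends by (intro map_le_antisym) (unfold map_le_def, (metis domD)+)
qed

section \<open>Operators with an intertwiner of nonvanishing numerical range\<close>

text \<open>\<open>d\<close> is the radius of a disc around \<open>0\<close> that misses the numerical range; the inequality for unit
  vectors scales quadratically.\<close>

lemma numerical_range_lower_bound:
  assumes "bounded_clinear S" and "0 \<notin> closure (numerical_range S)"
  obtains d where "0 < d" "\<And>x. d * (norm x)\<^sup>2 \<le> cmod (cinner (S x) x)"
proof -
  obtain d where d: "0 < d" "ball 0 d \<inter> closure (numerical_range S) = {}"
    using assms(2) open_contains_ball_eq[of "- closure (numerical_range S)"] by fastforce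
  have "d * (norm x)\<^sup>2 \<le> cmod (cinner (S x) x)" for x
  proof (cases "x = 0")
    case False
    define k where "k = 1 / norm x"
    define e where "e = complex_of_real k *\<^sub>C x"
    have k: "0 < k" "k * norm x = 1" using False by (simp_all add: k_def)
    then have "norm e = 1" by (simp add: e_def norm_scaleC)
    then have "cinner (S e) e \<in> numerical_range S"
      by (auto simp: numerical_range_def)
    then have "cinner (S e) e \<in> closure (numerical_range S)"
      by (rule subsetD[OF closure_subset])
    then have "d \<le> cmod (cinner (S e) e)"
      using d(2) by (auto simp: disjoint_iff not_less)
    moreover have "S e = complex_of_real k *\<^sub>C S x"
      using assms(1) by (simp add: bounded_clinear_def e_def)
    ultimately have "d \<le> k\<^sup>2 * cmod (cinner (S x) x)"
      using k(1) by (simp add: e_def cinner_linear norm_mult power2_eq_square mult.assoc)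
    then have "d * (norm x)\<^sup>2 \<le> (k\<^sup>2 * cmod (cinner (S x) x)) * (norm x)\<^sup>2"
      by (rule mult_right_mono) simp
    also have "\<dots> = (k * norm x)\<^sup>2 * cmod (cinner (S x) x)"
      by (simp only: power_mult_distrib mult_ac)
    finally show ?thesis by (simp add: k(2))
  qed simp
  then show thesis using that d(1) by blast
qed

text \<open>Put \<open>g = T\<^sup>*x - cnj z x\<close>, whose norm is at most \<open>\<parallel>(T - z)x\<parallel>\<close> by hyponormality. The
  intertwining relation gives \<open>\<langle>ST\<^sup>*x, x\<rangle> = \<langle>TSx, x\<rangle> = \<langle>Sx, T\<^sup>*x\<rangle>\<close>, so \<open>(cnj z - z) \<langle>Sx, x\<rangle>\<close> equals
  \<open>\<langle>Sx, g\<rangle> - \<langle>Sg, x\<rangle>\<close>, which is small when \<open>g\<close> is.\<close>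

lemma intertwined_shift_lower_bound:
  fixes S :: "'a::complex_inner \<Rightarrow> 'a"
  assumes S: "bounded_clinear S" and B: "\<And>x. norm (S x) \<le> B * norm x"
    and d: "\<And>x. d * (norm x)\<^sup>2 \<le> cmod (cinner (S x) x)"
    and hyp: "hyponormal T"
    and intertwine: "\<And>y v. adjoint_op T y = Some v \<Longrightarrow> T (S y) = Some (S v)"
    and Tx: "T x = Some u"
  shows "\<bar>Im z\<bar> * d * norm x \<le> B * norm (u - z *\<^sub>C x)"
proof (cases "x = 0")
  case True
  have "0 \<le> B * norm (u - z *\<^sub>C x)" using B norm_ge_zero order_trans by blast
  then show ?thesis using True by simp
next
  case False
  have dense: "densely_defined T" using hyp by (simp add: hyponormal_def)
  obtain v where v: "adjoint_op T x = Some v" "norm (v - cnj z *\<^sub>C x) \<le> norm (u - z *\<^sub>C x)"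
    using hyponormalE[OF hyp Tx] by blast
  define g where "g = v - cnj z *\<^sub>C x"
  have v_eq: "v = g + cnj z *\<^sub>C x" by (simp add: g_def)
  have Sv: "S v = S g + cnj z *\<^sub>C S x"
    using S by (simp add: v_eq bounded_clinear_def linear_simps(1))
  have B0: "0 \<le> B" using B[of x] False norm_ge_zero[of "S x"]
    by (metis order_trans zero_le_mult_iff zero_less_norm_iff not_le)
  have "cinner (S v) x = cinner (S x) v"
    using adjoint_op_eq_Some_iff[OF dense] v(1) intertwine[OF v(1)] by blast
  then have "(cnj z - z) * cinner (S x) x = cinner (S x) g - cinner (S g) x"
    unfolding Sv by (simp add: v_eq cinner_linear algebra_simps)
  then have "cmod (cnj z - z) * cmod (cinner (S x) x) = cmod (cinner (S x) g - cinner (S g) x)"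
    by (metis norm_mult)
  moreover have "cmod (cnj z - z) = 2 * \<bar>Im z\<bar>"
    by (simp add: cmod_def real_sqrt_mult)
  moreover have "cmod (cinner (S x) g - cinner (S g) x) \<le> 2 * (B * norm x * norm g)"
  proof -
    have "cmod (cinner (S x) g) \<le> B * norm x * norm g"
      by (rule order_trans[OF cinner_cauchy_schwarz mult_right_mono[OF B]]) simp
    moreover have "cmod (cinner (S g) x) \<le> B * norm g * norm x"
      by (rule order_trans[OF cinner_cauchy_schwarz mult_right_mono[OF B]]) simp
    ultimately show ?thesis
      using norm_triangle_ineq4[of "cinner (S x) g" "cinner (S g) x"] by (simp add: mult_ac)
  qed
  ultimately have "\<bar>Im z\<bar> * cmod (cinner (S x) x) \<le> B * norm x * norm g" by simp
  moreover have "\<bar>Im z\<bar> * (d * (norm x)\<^sup>2) \<le> \<bar>Im z\<bar> * cmod (cinner (S x) x)"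
    by (intro mult_left_mono d) simp
  ultimately have "(\<bar>Im z\<bar> * d * norm x) * norm x \<le> (B * norm g) * norm x"
    by (simp add: power2_eq_square mult_ac)
  then have "\<bar>Im z\<bar> * d * norm x \<le> B * norm g" using False by simp
  also have "\<dots> \<le> B * norm (u - z *\<^sub>C x)"
    using v(2) B0 by (simp add: g_def mult_left_mono)
  finally show ?thesis .
qed

theorem theorem3p1:
  fixes S :: "'a::complex_hilbert_space \<Rightarrow> 'a"
    and T :: "'a \<rightharpoonup> 'a"
  assumes separable: "\<exists>B :: 'a set. countable B \<and> closure B = UNIV"
    and "bounded_clinear S"
    and "0 \<notin> closure (numerical_range S)"
    and "linear_operator T"
    and "densely_defined T"
    and "closed_operator T"
    and "hyponormal T"
    and "(everywhere S \<circ>\<^sub>m adjoint_op T) \<subseteq>\<^sub>m (T \<circ>\<^sub>m everywhere S)"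
  shows "T = adjoint_op T"
proof -
  obtain d where d: "0 < d" "\<And>x. d * (norm x)\<^sup>2 \<le> cmod (cinner (S x) x)"
    using numerical_range_lower_bound[OF assms(2,3)] by blast
  obtain B where B: "0 < B" "\<And>x. norm (S x) \<le> B * norm x"
    using \<open>bounded_clinear S\<close> bounded_linear.pos_bounded
    unfolding bounded_clinear_def by (metis mult.commute)
  have intertwine: "T (S y) = Some (S v)" if "adjoint_op T y = Some v" for y v
  proof -
    have "(everywhere S \<circ>\<^sub>m adjoint_op T) y = Some (S v)"
      using that by (simp add: map_comp_def everywhere_def)
    then have "(T \<circ>\<^sub>m everywhere S) y = Some (S v)"
      using assms(8) unfolding map_le_def by (metis domI)
    then show ?thesis by (simp add: map_comp_def everywhere_def)
  qed
  have below: "\<bar>Im z\<bar> * d * norm x \<le> B * norm (u - z *\<^sub>C x)" if "T x = Some u" for x u z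
    by (rule intertwined_shift_lower_bound[OF assms(2) B(2) d(2) assms(7) intertwine that])
  have inj: "y = 0" if z: "Im z \<noteq> 0" and y: "adjoint_op T y = Some (z *\<^sub>C y)" for y z
  proof -
    have "T (S y) = Some (z *\<^sub>C S y)"
      using intertwine[OF y] \<open>bounded_clinear S\<close> by (simp add: bounded_clinear_def)
    from below[OF this, of z] have "\<bar>Im z\<bar> * d * norm (S y) \<le> 0" by simp
    then have "S y = 0" using z d(1) by (simp add: mult_le_0_iff)
    then have "d * (norm y)\<^sup>2 \<le> 0" using d(2)[of y] by (simp add: cinner_linear)
    then show ?thesis using d(1) by (simp add: mult_le_0_iff)
  qed
  have surj: "\<exists>x u. T x = Some u \<and> u - z *\<^sub>C x = w" if z: "Im z \<noteq> 0" for z w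
  proof (rule surj_shift_if_adjoint_inj[OF assms(4,5,6)])
    show "0 < \<bar>Im z\<bar> * d / B" using z d(1) B(1) by simp
    show "\<bar>Im z\<bar> * d / B * norm x \<le> norm (u - z *\<^sub>C x)" if "T x = Some u" for x u
      using below[OF that, of z] B(1) by (simp add: field_simps)
    show "y = 0" if "adjoint_op T y = Some (cnj z *\<^sub>C y)" for y
      using inj[OF _ that] z by simp
  qed
  have sharp: "\<bar>Im z\<bar> * norm x \<le> norm (u - z *\<^sub>C x)" if "T x = Some u" for x u z
  proof (rule hyponormal_shift_lower_bound[OF assms(4,7) _ _ surj that])
    show "0 < B / d" using B(1) d(1) by simp
    show "\<bar>Im z\<bar> * norm x \<le> B / d * norm (u - z *\<^sub>C x)" if "T x = Some u" for x u z
      using below[OF that, of z] d(1) by (simp add: field_simps)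
  qed
  have "Im (cinner u x) = 0" if "T x = Some u" for x u
  proof (rule Im_cinner_eq_0_if_shift_lower_bound)
    show "\<bar>t\<bar> * norm x \<le> norm (u - (\<i> * of_real t) *\<^sub>C x)" for t :: real
      using sharp[OF that, of "\<i> * of_real t"] by simp
  qed
  note sym = symmetric_if_cinner_real[OF assms(4) this]
  show ?thesis
  proof (rule self_adjoint_if_symmetric_and_surj[OF assms(5) sym])
    show "\<exists>x u. T x = Some u \<and> u - \<i> *\<^sub>C x = w" for w
      by (rule surj) simp
    show "y = 0" if "adjoint_op T y = Some (\<i> *\<^sub>C y)" for y
      using inj[OF _ that] by simp
  qed
qed

end
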